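(* Let $m = m_n \ge 1$ and let $f = f_n$ be a probability distribution on $\{1,\dots,n\}$ such that $m f(x)$ is an integer with $m f(x) \le \binom{n}{x}$ for every $x = 1,\dots,n$, and let $H_{nmf}$ be the random hypergraph defined in the context. Assume that $\sum_{x=1}^n \binom{n}{x}^{-1} f(x)^2 \ll m^{-2}$ and $(f)_2 \lesssim (f)_0$. Then, as $n\to\infty$, \[ \mathbb{P}(H_{nmf} \text{ is connected}) \to \begin{cases} 0 & \text{if } \log n - \frac{m}{n}(f)_1 \to +\infty,\\ 1 & \text{if } \log n - \frac{m}{n}(f)_1 \to -\infty.\end{cases} \]
   Context: A hypergraph $h=(V_h,E_h)$ consists of a finite node set $V_h$ and a collection $E_h$ of nonempty subsets of $V_h$ (hyperedges). It is connected if for every partition of $V_h$ into nonempty sets $V_1,V_2$ there is a hyperedge $e\in E_h$ with $e\cap V_1\neq\emptyset$ and $e\cap V_2\ne\emptyset$. The empirical hyperedge size distribution of $h$ is $f(x) = |E_h|^{-1}\sum_{e\in E_h} 1(|e| = x)$. $\mathcal{H}_{nmf}$ denotes the set of hypergraphs on node set $\{1,\dots,n\}$ with exactly $m$ (distinct) hyperedges and empirical hyperedge size distribution $f$; $H_{nmf}$ is a uniformly random element of $\mathcal{H}_{nmf}$. Moments: $(f)_r = \sum_{x=2}^n x^r f(x)$. Asymptotic notation: $a_n \ll b_n$ means $a_n/|b_n|\to 0$; $a_n\lesssim b_n$ means $\limsup a_n/|b_n| <\infty$. *)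

theory Defs
  imports "HOL-Analysis.Analysis" "HOL-Library.Landau_Symbols"
begin

definition hg_connected :: "nat set \<Rightarrow> nat set set \<Rightarrow> bool" where
  "hg_connected V E \<longleftrightarrow>
     (\<forall>V1 V2. V1 \<noteq> {} \<and> V2 \<noteq> {} \<and> V1 \<inter> V2 = {} \<and> V1 \<union> V2 = V \<longrightarrow>
        (\<exists>e\<in>E. e \<inter> V1 \<noteq> {} \<and> e \<inter> V2 \<noteq> {}))"

definition emp_size_dist :: "nat set set \<Rightarrow> nat \<Rightarrow> real" where
  "emp_size_dist E x = real (card {e\<in>E. card e = x}) / real (card E)"

definition hgraphs :: "nat \<Rightarrow> nat \<Rightarrow> (nat \<Rightarrow> real) \<Rightarrow> nat set set set" where
  "hgraphs n m f = {E. E \<subseteq> Pow {1..n} \<and> {} \<notin> E \<and> card E = m \<and>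
                        (\<forall>x\<in>{1..n}. emp_size_dist E x = f x)}"

definition prob_connected :: "nat \<Rightarrow> nat \<Rightarrow> (nat \<Rightarrow> real) \<Rightarrow> real" where
  "prob_connected n m f =
     real (card {E\<in>hgraphs n m f. hg_connected {1..n} E}) / real (card (hgraphs n m f))"

definition moment :: "nat \<Rightarrow> nat \<Rightarrow> (nat \<Rightarrow> real) \<Rightarrow> real" where
  "moment r n f = (\<Sum>x=2..n. real x ^ r * f x)"

end

(*
  Writing k x = m f(x), a uniform element of hgraphs n m f consists of independent uniform k x-subsets
  of the x-sets, so the probability that all hyperedges lie in a given family of sets is an explicit
  product of ratios of binomial coefficients.  Let L = (m / n) (f)_1.

  If ln n - L tends to +infinity, count the vertices lying in no hyperedge of size at least two.
  Two such isolation events are negatively correlated, so the variance is at most the mean and the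
  probability of having no isolated vertex is at most the inverse of the mean.  The mean is at least
  exp (ln n - L - 1) for large n: the moment condition forces all occurring sizes to be O(sqrt (n ln n)),
  and the first hypothesis controls the effect of sampling without replacement.

  If ln n - L tends to -infinity, say L = ln n + w, take the union bound over the smaller part A of
  a partition.  With t = |A| / n at most 1/2, the probability that no hyperedge crosses is at most
  exp (- |A| L (1 - 3t/2)), and after multiplication by the number of sets of that size the
  contributions are dominated by a geometric series of ratio exp (5/2 - w/4).
*)

theory Submission
  imports Defs
begin

section \<open>Counting families with prescribed class sizes\<close>

text \<open>The ground set \<open>S\<close> is a parameter so that an event of the form "every
  hyperedge lies in \<open>S\<close>" is again such a collection, only with a smaller ground set.
  The map \<open>g\<close> is later always \<open>card\<close>.\<close>

definition class_families :: "'a set \<Rightarrow> ('a \<Rightarrow> 'b) \<Rightarrow> 'b set \<Rightarrow> ('b \<Rightarrow> nat) \<Rightarrow> 'a set set" where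
  "class_families S g X k = {E. E \<subseteq> S \<and> (\<forall>x\<in>X. card {e\<in>E. g e = x} = k x)}"

lemma finite_class_families: "finite S \<Longrightarrow> finite (class_families S g X k)"
  unfolding class_families_def by (rule finite_subset[of _ "Pow S"]) auto

text \<open>A family is the same thing as an independent choice of a \<open>k x\<close>-subset in
  each fibre of \<open>g\<close>. Since \<open>g\<close> maps \<open>S\<close> into
  \<open>X\<close>, the fibres over \<open>X\<close> cover \<open>S\<close>, so a family is
  recovered as the union of its classes.\<close>

lemma card_class_families:
  assumes S: "finite S" and X: "finite X" and gX: "g ` S \<subseteq> X"
  shows "card (class_families S g X k) = (\<Prod>x\<in>X. card {e\<in>S. g e = x} choose k x)"
proof -
  let ?P = "PiE X (\<lambda>x. {B. B \<subseteq> {e\<in>S. g e = x} \<and> card B = k x})"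
  have "bij_betw (\<lambda>E. \<lambda>x\<in>X. {e\<in>E. g e = x}) (class_families S g X k) ?P"
  proof (rule bij_betw_byWitness[where f' = "\<lambda>B. \<Union>x\<in>X. B x"])
    show "\<forall>E\<in>class_families S g X k. (\<Union>x\<in>X. (\<lambda>x\<in>X. {e\<in>E. g e = x}) x) = E"
      using gX by (auto simp: class_families_def)
    have *: "{e \<in> \<Union> (B ` X). g e = x} = B x" if "B \<in> ?P" "x \<in> X" for B x
    proof -
      have "B y \<subseteq> {e\<in>S. g e = y}" if "y \<in> X" for y
        using PiE_mem[OF \<open>B \<in> ?P\<close> that] by simp
      then show ?thesis using \<open>x \<in> X\<close> by blast
    qed
    show "\<forall>B\<in>?P. (\<lambda>x\<in>X. {e \<in> \<Union> (B ` X). g e = x}) = B"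
    proof
      fix B assume B: "B \<in> ?P"
      show "(\<lambda>x\<in>X. {e \<in> \<Union> (B ` X). g e = x}) = B"
      proof
        fix x
        show "(\<lambda>x\<in>X. {e \<in> \<Union> (B ` X). g e = x}) x = B x"
          using *[OF B] PiE_arb[OF B] by (cases "x \<in> X") auto
      qed
    qed
    show "(\<lambda>E. \<lambda>x\<in>X. {e\<in>E. g e = x}) ` class_families S g X k \<subseteq> ?P"
      by (auto simp: class_families_def)
    show "(\<lambda>B. \<Union>x\<in>X. B x) ` ?P \<subseteq> class_families S g X k"
    proof
      fix E assume "E \<in> (\<lambda>B. \<Union>x\<in>X. B x) ` ?P"
      then obtain B where B: "B \<in> ?P" "E = (\<Union>x\<in>X. B x)" by blast
      have "B x \<subseteq> {e\<in>S. g e = x} \<and> card (B x) = k x" if "x \<in> X" for x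
        using PiE_mem[OF B(1) that] by simp
      then show "E \<in> class_families S g X k"
        using *[OF B(1)] unfolding class_families_def B(2) by auto
    qed
  qed
  then have "card (class_families S g X k) = card ?P" by (rule bij_betw_same_card)
  also have "\<dots> = (\<Prod>x\<in>X. card {B. B \<subseteq> {e\<in>S. g e = x} \<and> card B = k x})"
    using X by (rule card_PiE)
  also have "\<dots> = (\<Prod>x\<in>X. card {e\<in>S. g e = x} choose k x)"
    using S by (intro prod.cong refl n_subsets) auto
  finally show ?thesis .
qed

section \<open>Ratios of binomial coefficients and a second moment bound\<close>

lemma binomial_eq_prod: "real (n choose k) = (\<Prod>i<k. real n - real i) / fact k"
  by (simp add: binomial_gbinomial gbinomial_prod_rev atLeast0LessThan)

text \<open>Sampling without replacement from \<open>N\<close> hits a part of size \<open>a\<close>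
  each time with probability at most that with replacement: every factor
  \<open>(a - i) / (N - i)\<close> is at most \<open>a / N\<close>. It serves both for vertices
  inside a hyperedge and for hyperedges among all sets of one size.\<close>

lemma binomial_ratio_le_power:
  assumes "a \<le> N" "k \<le> N"
  shows "real (a choose k) / real (N choose k) \<le> (real a / real N) ^ k"
proof (cases "k \<le> a")
  case True
  have "real (a choose k) / real (N choose k) = (\<Prod>i<k. (real a - real i) / (real N - real i))"
    by (simp add: binomial_eq_prod prod_dividef)
  also have "\<dots> \<le> (\<Prod>i<k. real a / real N)"
  proof (rule prod_mono)
    fix i assume "i \<in> {..<k}"
    then have i: "real i < real N" "real i \<le> real a" using True assms by auto
    have "real i * real a \<le> real i * real N" using assms by (intro mult_left_mono) auto
    then show "0 \<le> (real a - real i) / (real N - real i) \<and>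
        (real a - real i) / (real N - real i) \<le> real a / real N"
      using i by (auto simp: field_simps)
  qed
  also have "\<dots> = (real a / real N) ^ k" by simp
  finally show ?thesis .
qed (simp add: binomial_eq_0)

text \<open>The inequality holds factor by factor: expanding \<open>(a - i) (c - i)\<close> and
  \<open>(b - i)\<close> squared, the first two assumptions compare the linear and constant terms.
  It is applied to the numbers of \<open>x\<close>-sets avoiding two, one and no given
  vertices.\<close>

lemma binomial_mult_le_square:
  assumes "a + c \<ge> 2 * b" "a * c \<le> b\<^sup>2" "a \<le> b" "b \<le> c"
  shows "(a choose k) * (c choose k) \<le> (b choose k)\<^sup>2"
proof (cases "k \<le> a")
  case True
  have "(\<Prod>i<k. (real a - real i) * (real c - real i)) \<le> (\<Prod>i<k. (real b - real i)\<^sup>2)"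
  proof (rule prod_mono)
    fix i assume "i \<in> {..<k}"
    then have i: "real i \<le> real a" "real a \<le> real c" using True assms by auto
    have "real i * (2 * real b) \<le> real i * (real a + real c)"
      using assms(1) by (intro mult_left_mono) (auto simp flip: of_nat_add of_nat_mult)
    moreover have "real a * real c \<le> (real b)\<^sup>2"
      using assms(2) by (metis of_nat_le_iff of_nat_mult of_nat_power)
    ultimately have "(real a - real i) * (real c - real i) \<le> (real b - real i)\<^sup>2"
      by (simp add: power2_eq_square algebra_simps)
    then show "0 \<le> (real a - real i) * (real c - real i) \<and>
        (real a - real i) * (real c - real i) \<le> (real b - real i)\<^sup>2"
      using i by simp
  qed
  then have "real (a choose k) * real (c choose k) \<le> (real (b choose k))\<^sup>2"
    by (simp add: binomial_eq_prod prod.distrib prod_power_distrib power_divide divide_right_mono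
        power2_eq_square)
  then show ?thesis
    by (metis of_nat_le_iff of_nat_mult of_nat_power)
qed (simp add: binomial_eq_0)

text \<open>The ratio is the probability that a fixed vertex avoids \<open>k\<close> distinct random
  \<open>x\<close>-sets. The main exponent is \<open>x k / n\<close>; the second summand pays for
  sampling without replacement, the third for the quadratic term of the logarithm.\<close>

lemma exp_le_binomial_ratio:
  fixes n x k :: nat
  defines "N \<equiv> n choose x"
  assumes n: "n > 0" and x: "4 * x \<le> n" and k: "4 * (real k)\<^sup>2 \<le> real N"
  shows "exp (- (real x * real k / n + (real k)\<^sup>2 / N + 8 * (real x)\<^sup>2 * real k / (real n)\<^sup>2))
    \<le> real (((n - 1) choose x) choose k) / real (N choose k)"
proof -
  define N1 where "N1 = (n - 1) choose x"
  define t where "t = real x / real n"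
  have N: "real N > 0" using x by (simp add: N_def)
  have t: "0 \<le> t" "t \<le> 1/4" using x n by (auto simp: t_def field_simps)
  have "(n - x) * N = n * N1" by (simp add: N_def N1_def binomial_absorb_comp)
  then have "real (n - x) * real N = real n * real N1" by (metis of_nat_mult)
  then have N1: "real N1 = real N - t * real N"
    using n x by (simp add: t_def field_simps of_nat_diff)
  have "exp (- (t + 4 * t * k / N + 8 * t\<^sup>2)) ^ k
      = (\<Prod>i<k. exp (- (t + 4 * t * k / N + 8 * t\<^sup>2)))" by simp
  also have "\<dots> \<le> (\<Prod>i<k. (real N1 - real i) / (real N - real i))"
  proof (rule prod_mono)
    fix i assume "i \<in> {..<k}"
    then have i: "real i \<le> real k" "1 \<le> real k" by auto
    have "4 * real k \<le> 4 * (real k)\<^sup>2" using i by (simp add: power2_eq_square)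
    then have ki: "4 * real i \<le> real N" "4 * real k \<le> real N" using i k by linarith+
    \<comment> \<open>This \<open>y\<close> is the conditional probability that the next set
      contains the vertex when \<open>i\<close> sets avoiding it are already drawn, so
      \<open>1 - y\<close> is exactly the \<open>i\<close>-th factor.\<close>
    define y where "y = t * (real N / (real N - real i))"
    have "real N / (real N - real i) \<le> 2" "real N / (real N - real i) \<ge> 0"
      using ki N by (auto simp: field_simps)
    then have y: "0 \<le> y" "y \<le> t * 2" unfolding y_def using t
      by (intro mult_nonneg_nonneg mult_left_mono; simp)+
    have "real N / (real N - real i) = 1 + real i / (real N - real i)"
      using ki N by (simp add: field_simps)
    also have "real i / (real N - real i) \<le> real k / (real N / 4)"
      using ki N i by (intro frac_le) auto
    finally have "y \<le> t * (1 + real k / (real N / 4))"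
      unfolding y_def using t by (intro mult_left_mono) auto
    then have y1: "y \<le> t + 4 * t * k / N" using N by (simp add: field_simps)
    have "y\<^sup>2 \<le> (t * 2)\<^sup>2" using y by (intro power_mono)
    then have y2: "2 * y\<^sup>2 \<le> 8 * t\<^sup>2" by (simp add: power_mult_distrib)
    have "- (t + 4 * t * k / N + 8 * t\<^sup>2) \<le> - y - 2 * y\<^sup>2"
      using y1 y2 by simp
    \<comment> \<open>The logarithmic bound requires \<open>y\<close> to be at most 1/2, which is
      where \<open>t \<le> 1/4\<close> enters.\<close>
    also have "\<dots> \<le> ln (1 - y)"
      using y t by (intro ln_one_minus_pos_lower_bound) auto
    finally have "exp (- (t + 4 * t * k / N + 8 * t\<^sup>2)) \<le> 1 - y"
      using y t by (simp add: ln_ge_iff)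
    also have "1 - y = (real N1 - real i) / (real N - real i)"
      unfolding N1 y_def using ki N by (simp add: field_simps)
    finally show "0 \<le> exp (- (t + 4 * t * k / N + 8 * t\<^sup>2)) \<and>
        exp (- (t + 4 * t * k / N + 8 * t\<^sup>2)) \<le> (real N1 - real i) / (real N - real i)"
      by simp
  qed
  also have "\<dots> = real (N1 choose k) / real (N choose k)"
    by (simp add: binomial_eq_prod prod_dividef)
  finally have main: "exp (- (t + 4 * t * k / N + 8 * t\<^sup>2)) ^ k \<le> real (N1 choose k) / real (N choose k)" .
  have "4 * t * ((real k)\<^sup>2 / N) \<le> 1 * ((real k)\<^sup>2 / N)"
    using t N by (intro mult_right_mono) auto
  then have "- (real x * real k / n + (real k)\<^sup>2 / N + 8 * (real x)\<^sup>2 * real k / (real n)\<^sup>2)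
     \<le> real k * - (t + 4 * t * k / N + 8 * t\<^sup>2)"
    by (simp add: t_def power2_eq_square algebra_simps)
  then have "exp (- (real x * real k / n + (real k)\<^sup>2 / N + 8 * (real x)\<^sup>2 * real k / (real n)\<^sup>2))
      \<le> exp (- (t + 4 * t * k / N + 8 * t\<^sup>2)) ^ k"
    by (simp only: exp_of_nat_mult[symmetric] exp_le_cancel_iff)
  with main show ?thesis unfolding N1_def by linarith
qed

text \<open>The last assumption is exact negative correlation: it bounds the variance of the number of
  \<open>v\<close> with \<open>P v E\<close> by its mean, so Chebyshev's inequality applies.\<close>

lemma second_moment_count:
  assumes H: "finite H" and V: "finite V"
    and a: "\<And>v. v \<in> V \<Longrightarrow> card {E\<in>H. P v E} = a"
    and b: "\<And>u v. u \<in> V \<Longrightarrow> v \<in> V \<Longrightarrow> u \<noteq> v \<Longrightarrow> card {E\<in>H. P u E \<and> P v E} * card H \<le> a\<^sup>2"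
  shows "real (card {E\<in>H. \<forall>v\<in>V. \<not> P v E}) * (real (card V) * real a) \<le> (real (card H))\<^sup>2"
proof (cases "card H = 0 \<or> real (card V) * real a = 0")
  case True
  then show ?thesis using H by auto
next
  case False
  define h where "h = real (card H)"
  define c where "c = real (card V) * real a"
  define X where "X E = (\<Sum>v\<in>V. of_bool (P v E) :: real)" for E
  define z where "z = real (card {E\<in>H. \<forall>v\<in>V. \<not> P v E})"
  have pos: "h > 0" "c > 0" using False unfolding h_def c_def
    by (auto simp: zero_less_mult_iff)
  have sum_of_bool: "(\<Sum>E\<in>H. of_bool (Q E) :: real) = real (card {E\<in>H. Q E})" for Q
    using H by (simp add: of_bool_def sum.If_cases Int_def)
  have X1: "(\<Sum>E\<in>H. X E) = c"
    unfolding X_def by (subst sum.swap) (simp add: sum_of_bool a c_def)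
  have "(\<Sum>E\<in>H. (X E)\<^sup>2) = (\<Sum>E\<in>H. \<Sum>u\<in>V. \<Sum>v\<in>V. of_bool (P u E \<and> P v E))"
    by (simp add: X_def power2_eq_square sum_product of_bool_conj)
  also have "\<dots> = (\<Sum>u\<in>V. \<Sum>v\<in>V. \<Sum>E\<in>H. of_bool (P u E \<and> P v E))"
    by (subst sum.swap, rule sum.cong[OF refl], rule sum.swap)
  also have "\<dots> = (\<Sum>u\<in>V. \<Sum>v\<in>V. real (card {E\<in>H. P u E \<and> P v E}))"
    by (simp only: sum_of_bool)
  also have "\<dots> \<le> (\<Sum>u\<in>V. \<Sum>v\<in>V. (real a)\<^sup>2 / h + (if u = v then real a else 0))"
  proof (intro sum_mono)
    fix u v assume uv: "u \<in> V" "v \<in> V"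
    show "real (card {E\<in>H. P u E \<and> P v E}) \<le> (real a)\<^sup>2 / h + (if u = v then real a else 0)"
    proof (cases "u = v")
      case True
      then show ?thesis using a[OF uv(1)] pos by simp
    next
      case False
      have "real (card {E\<in>H. P u E \<and> P v E}) * h \<le> (real a)\<^sup>2"
        using b[OF uv False] unfolding h_def by (metis of_nat_le_iff of_nat_mult of_nat_power)
      then show ?thesis using pos False by (simp add: field_simps)
    qed
  qed
  also have "\<dots> = c\<^sup>2 / h + c"
    using V by (simp add: sum.distrib c_def power2_eq_square algebra_simps)
  finally have X2: "(\<Sum>E\<in>H. (X E)\<^sup>2) \<le> c\<^sup>2 / h + c" .
  \<comment> \<open>\<open>X E\<close> vanishes on the families counted by \<open>z\<close>, so each
    of them has the same squared deviation from the mean \<open>c / h\<close>.\<close>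
  have "z * (c / h)\<^sup>2 = (\<Sum>E\<in>{E\<in>H. \<forall>v\<in>V. \<not> P v E}. (X E - c / h)\<^sup>2)"
    by (simp add: z_def X_def)
  also have "\<dots> \<le> (\<Sum>E\<in>H. (X E - c / h)\<^sup>2)"
    using H by (intro sum_mono2) auto
  also have "\<dots> = (\<Sum>E\<in>H. (X E)\<^sup>2) - 2 * (c / h) * (\<Sum>E\<in>H. X E) + h * (c / h)\<^sup>2"
  proof -
    have "(X E - c / h)\<^sup>2 = (X E)\<^sup>2 - 2 * (c / h) * X E + (c / h)\<^sup>2" for E
      by (simp add: power2_diff algebra_simps)
    then show ?thesis
      by (simp only: sum.distrib sum_subtractf sum_distrib_left[symmetric] sum_constant h_def)
  qed
  also have "\<dots> \<le> c"
    using X2 pos unfolding X1 by (simp add: power2_eq_square field_simps)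
  finally have "z * c * c \<le> h\<^sup>2 * c"
    using pos by (simp add: power2_eq_square field_simps)
  then have "z * c \<le> h\<^sup>2" using pos by simp
  then show ?thesis by (simp add: z_def c_def h_def)
qed


section \<open>Analytic estimates for the union bound\<close>

text \<open>A single term \<open>t ^ n / fact n\<close> of the exponential series is at most
  \<open>exp t\<close>. With \<open>t = n\<close> this is a weak Stirling bound.\<close>

lemma mult_ln_le_ln_fact:
  fixes t :: real
  assumes "0 < t"
  shows "real n * ln t \<le> t + ln (fact n)"
proof -
  have "(\<Sum>i\<in>{n}. t ^ i /\<^sub>R fact i) \<le> exp t"
    unfolding exp_def using assms summable_exp_generic[of t] by (intro sum_le_suminf) auto
  then have "t ^ n \<le> exp t * fact n" by (simp add: field_simps)
  then have "ln (t ^ n) \<le> ln (exp t * fact n)" using assms by (subst ln_le_cancel_iff) auto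
  then show ?thesis using assms by (simp add: ln_mult ln_realpow)
qed

text \<open>The left side bounds the probability that a random \<open>x\<close>-set does not cross a
  cut with parts \<open>t n\<close> and \<open>(1 - t) n\<close>. After factoring out
  \<open>exp (- t) ^ x\<close>, the smaller part leaves only a correction of order \<open>t\<close>
  squared. The exponent is kept linear in \<open>x\<close>, so that the product over hyperedges
  depends on the first moment alone.\<close>

lemma power_sum_le_exp:
  fixes t :: real
  assumes t: "0 \<le> t" "t \<le> 1/2" and x: "x \<ge> 2"
  shows "(1 - t) ^ x + t ^ x \<le> exp (- (real x * t * (1 - 3/2 * t)))"
proof -
  define u where "u = t * exp t"
  have "exp t \<le> exp (1/2)" using t by simp
  also have "\<dots> \<le> (2::real)" by (rule exp_half_le2)
  finally have "u \<le> 1/2 * 2" unfolding u_def using t by (intro mult_mono) auto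
  \<comment> \<open>Because \<open>u\<close> is at most 1, the exponent can be lowered to 2,
    uniformly in \<open>x\<close>.\<close>
  then have "u ^ x \<le> u\<^sup>2" using t x by (intro power_decreasing) (auto simp: u_def)
  also have "\<dots> = t\<^sup>2 * exp (2 * t)"
    by (simp add: u_def power_mult_distrib flip: exp_double)
  also have "\<dots> \<le> t\<^sup>2 * 3"
    using t exp_le by (intro mult_left_mono) (auto intro: order_trans[of _ "exp 1"])
  finally have u: "u ^ x \<le> 3 * t\<^sup>2" by simp
  have "t = exp (- t) * u" by (simp add: u_def exp_minus field_simps)
  then have "t ^ x = exp (- t) ^ x * u ^ x" by (metis power_mult_distrib)
  moreover have "(1 - t) ^ x \<le> exp (- t) ^ x"
    using t exp_ge_add_one_self[of "- t"] by (intro power_mono) auto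
  ultimately have "(1 - t) ^ x + t ^ x \<le> exp (- t) ^ x * (1 + u ^ x)"
    by (simp add: algebra_simps)
  also have "\<dots> \<le> exp (- t) ^ x * exp (3 * t\<^sup>2)"
    using u order_trans[OF _ exp_ge_add_one_self[of "3 * t\<^sup>2"]] by (intro mult_left_mono) auto
  also have "\<dots> = exp (- (real x * t) + 3 * t\<^sup>2)"
    unfolding exp_add exp_of_nat_mult[symmetric] by simp
  also have "\<dots> \<le> exp (- (real x * t * (1 - 3/2 * t)))"
  proof -
    \<comment> \<open>The correction is absorbed into the term linear in \<open>x\<close> by using
      \<open>x \<ge> 2\<close>; this is the origin of the constant 3/2.\<close>
    have "3/2 * t\<^sup>2 * 2 \<le> 3/2 * t\<^sup>2 * real x"
      using x by (intro mult_left_mono) auto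
    then show ?thesis by (simp add: algebra_simps power2_eq_square)
  qed
  finally show ?thesis .
qed

text \<open>Writing \<open>t = j / n\<close>, the loss \<open>3/2 t ln n\<close> from \<open>power_sum_le_exp\<close> is
  absorbed by the factorial in \<open>n choose j\<close>, since \<open>t ln n = t ln j + t ln (1 / t) \<le> t ln j + 1\<close>.\<close>

lemma binomial_mult_exp_le:
  fixes n j :: nat and w L :: real
  assumes j: "1 \<le> j" "2 * j \<le> n" and w: "0 \<le> w" "ln n + w \<le> L"
  shows "real (n choose j) * exp (- (real j * L * (1 - 3/2 * (real j / n)))) \<le> exp (- (w / 4 - 5/2)) ^ j"
proof -
  define t where "t = real j / real n"
  have t: "0 < t" "t \<le> 1/2" using j by (auto simp: t_def field_simps)
  have n: "real n > 0" using j by simp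
  have "(n choose j) * fact j \<le> n ^ j" by (rule binomial_fact_pow)
  then have "real (n choose j) * fact j \<le> real n ^ j"
    by (metis of_nat_fact of_nat_le_iff of_nat_mult of_nat_power)
  then have "ln (real (n choose j) * fact j) \<le> ln (real n ^ j)"
    using j n by (subst ln_le_cancel_iff) auto
  then have "ln (real (n choose j)) + ln (fact j) \<le> real j * ln n"
    using j n by (simp add: ln_mult ln_realpow)
  moreover have "real j * ln j \<le> real j + ln (fact j)"
    using j by (intro mult_ln_le_ln_fact) auto
  ultimately have 1: "ln (real (n choose j)) \<le> real j * (ln n - ln j + 1)"
    by (simp add: algebra_simps)
  have "t * ln (1 / t) \<le> t * (1 / t - 1)"
    using t by (intro mult_left_mono ln_le_minus_one) auto
  also have "\<dots> \<le> 1" using t by (simp add: algebra_simps)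
  finally have "t * ln (1 / t) \<le> 1" .
  moreover have "ln (1 / t) = ln n - ln j" using j n by (simp add: t_def ln_div)
  ultimately have "t * ln n \<le> t * ln j + 1" by (simp add: algebra_simps)
  moreover have "3/2 * t * ln j \<le> 1 * ln j" using t j by (intro mult_right_mono) auto
  ultimately have 2: "3/2 * t * ln n \<le> ln j + 3/2" by linarith
  have "(ln n + w) * (1 - 3/2 * t) \<le> L * (1 - 3/2 * t)"
    using t w by (intro mult_right_mono) auto
  \<comment> \<open>At \<open>t = 1/2\<close> the factor \<open>1 - 3/2 * t\<close> reaches its
    minimum 1/4, hence \<open>w / 4\<close> in the ratio.\<close>
  moreover have "w * (1/4) \<le> w * (1 - 3/2 * t)" using t w by (intro mult_left_mono) auto
  moreover have "(ln n + w) * (1 - 3/2 * t) = ln n - 3/2 * t * ln n + w * (1 - 3/2 * t)"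
    by (simp add: algebra_simps)
  \<comment> \<open>The 5/2 is the sum of 1 from the factorial bound and 3/2 from fact
    \<open>2\<close>.\<close>
  ultimately have "ln n - ln j + 1 - L * (1 - 3/2 * t) \<le> - (w / 4 - 5/2)"
    using 2 by linarith
  then have "real j * (ln n - ln j + 1 - L * (1 - 3/2 * t)) \<le> real j * - (w / 4 - 5/2)"
    by (intro mult_left_mono) auto
  with 1 have "ln (real (n choose j)) + - (real j * L * (1 - 3/2 * t)) \<le> real j * - (w / 4 - 5/2)"
    by (simp add: algebra_simps)
  then have "exp (ln (real (n choose j)) + - (real j * L * (1 - 3/2 * t))) \<le> exp (real j * - (w / 4 - 5/2))"
    by (simp only: exp_le_cancel_iff)
  then show ?thesis
    using j unfolding t_def[symmetric] exp_of_nat_mult exp_add by simp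
qed

section \<open>Families of hyperedges on \<open>{1..n}\<close>\<close>

definition nonempty_subsets :: "nat \<Rightarrow> nat set set" where
  "nonempty_subsets n = Pow {1..n} - {{}}"

abbreviation sized_families :: "nat set set \<Rightarrow> nat \<Rightarrow> (nat \<Rightarrow> nat) \<Rightarrow> nat set set set" where
  "sized_families S n k \<equiv> class_families S card {1..n} k"

lemma finite_nonempty_subsets: "finite (nonempty_subsets n)"
  by (simp add: nonempty_subsets_def)

lemma card_nonempty_subsets: "card ` nonempty_subsets n \<subseteq> {1..n}"
proof -
  have "card e \<le> n" "card e \<noteq> 0" if "e \<subseteq> {1..n}" "e \<noteq> {}" for e
    using that card_mono[of "{1..n}" e] finite_subset[of e "{1..n}"] by auto
  then show ?thesis by (force simp: nonempty_subsets_def Suc_le_eq)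
qed

lemma card_sized_families:
  assumes "S \<subseteq> nonempty_subsets n"
  shows "card (sized_families S n k) = (\<Prod>x=1..n. card {e\<in>S. card e = x} choose k x)"
  using assms card_nonempty_subsets[of n] finite_subset[OF assms finite_nonempty_subsets]
  by (intro card_class_families) auto

lemma card_subsets_of_size:
  assumes "A \<subseteq> {1..n}" "x \<ge> 1"
  shows "card {e\<in>nonempty_subsets n. e \<subseteq> A \<and> card e = x} = card A choose x"
proof -
  have "{e\<in>nonempty_subsets n. e \<subseteq> A \<and> card e = x} = {e. e \<subseteq> A \<and> card e = x}"
    using assms by (auto simp: nonempty_subsets_def)
  then show ?thesis using assms by (simp add: n_subsets finite_subset)
qed

lemma card_all_families:
  "card (sized_families (nonempty_subsets n) n k) = (\<Prod>x=1..n. (n choose x) choose k x)"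
proof -
  have "card {e\<in>nonempty_subsets n. card e = x} = n choose x" if "x \<in> {1..n}" for x
  proof -
    have "{e\<in>nonempty_subsets n. card e = x} = {e\<in>nonempty_subsets n. e \<subseteq> {1..n} \<and> card e = x}"
      by (auto simp: nonempty_subsets_def)
    then show ?thesis using that card_subsets_of_size[of "{1..n}" n x] by simp
  qed
  then show ?thesis by (subst card_sized_families) auto
qed

section \<open>Union bound over uncrossed cuts\<close>

definition uncut_sets :: "nat \<Rightarrow> nat set \<Rightarrow> nat set set" where
  "uncut_sets n A = {e\<in>nonempty_subsets n. e \<subseteq> A \<or> e \<subseteq> {1..n} - A}"

lemma card_uncut_families:
  assumes A: "A \<subseteq> {1..n}"
  shows "card (sized_families (uncut_sets n A) n k)
    = (\<Prod>x=1..n. ((card A choose x) + (n - card A choose x)) choose k x)"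
proof -
  have "card {e\<in>uncut_sets n A. card e = x} = (card A choose x) + (n - card A choose x)"
    if x: "x \<in> {1..n}" for x
  proof -
    let ?F = "\<lambda>A. {e\<in>nonempty_subsets n. e \<subseteq> A \<and> card e = x}"
    have "{e\<in>uncut_sets n A. card e = x} = ?F A \<union> ?F ({1..n} - A)"
      by (auto simp: uncut_sets_def)
    moreover have "?F A \<inter> ?F ({1..n} - A) = {}" by (auto simp: nonempty_subsets_def)
    ultimately have "card {e\<in>uncut_sets n A. card e = x} = card (?F A) + card (?F ({1..n} - A))"
      using finite_nonempty_subsets by (simp add: card_Un_disjoint)
    also have "\<dots> = (card A choose x) + (card ({1..n} - A) choose x)"
      using A x by (intro arg_cong2[of _ _ _ _ "(+)"] card_subsets_of_size) auto
    also have "card ({1..n} - A) = n - card A"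
      using A by (simp add: card_Diff_subset finite_subset)
    finally show ?thesis .
  qed
  then show ?thesis by (subst card_sized_families) (auto simp: uncut_sets_def)
qed

text \<open>The different sizes are independent, so the ratio is a product over \<open>x\<close>.
  For each size the fraction of uncut sets is bounded by \<open>power_sum_le_exp\<close> and raised
  to the power \<open>k x\<close>; the exponents add up to the stated multiple of
  \<open>L\<close>.\<close>

lemma uncut_ratio_le:
  assumes A: "A \<subseteq> {1..n}" "A \<noteq> {}" "2 * card A \<le> n" and k: "\<And>x. x \<in> {1..n} \<Longrightarrow> k x \<le> n choose x"
  defines "L \<equiv> (\<Sum>x=2..n. real x * real (k x)) / n"
  shows "real (card (sized_families (uncut_sets n A) n k))
    \<le> exp (- (real (card A) * L * (1 - 3/2 * (real (card A) / n))))
       * real (card (sized_families (nonempty_subsets n) n k))"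
proof -
  define j where "j = card A"
  define t where "t = real j / n"
  \<comment> \<open>Singletons are never cut, so size 1 contributes nothing to the exponent.\<close>
  define D where "D x = (if x \<ge> 2 then real x * real (k x) * (t * (1 - 3/2 * t)) else 0)" for x
  have "j \<noteq> 0" using A finite_subset[of A "{1..n}"] by (auto simp: j_def)
  then have j: "1 \<le> j" "2 * j \<le> n" using A by (auto simp: j_def)
  have t: "0 < t" "t \<le> 1/2" using j by (auto simp: t_def field_simps)
  have binom_le: "real (i choose x) \<le> (real i / n) ^ x * real (n choose x)" if "i \<le> n" "x \<le> n" for i x
    using binomial_ratio_le_power[OF that] that by (simp add: divide_le_eq)
  have "real (card (sized_families (uncut_sets n A) n k))
    = (\<Prod>x=1..n. real (((j choose x) + (n - j choose x)) choose k x))"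
    using A by (simp only: card_uncut_families j_def of_nat_prod)
  also have "\<dots> \<le> (\<Prod>x=1..n. exp (- D x) * real ((n choose x) choose k x))"
  proof (rule prod_mono)
    fix x assume x: "x \<in> {1..n}"
    let ?c = "(j choose x) + (n - j choose x)"
    have "real (?c choose k x) \<le> exp (- D x) * real ((n choose x) choose k x)"
    proof (cases "x \<ge> 2")
      case False
      with x have "x = 1" by simp
      then show ?thesis using j by (simp add: D_def)
    next
      case True
      have pos: "real (n choose x) > 0" using x by simp
      have "real ?c \<le> (t ^ x + (1 - t) ^ x) * real (n choose x)"
        using binom_le[of j x] binom_le[of "n - j" x] j x
        by (simp add: t_def of_nat_diff diff_divide_distrib algebra_simps)
      also have "\<dots> \<le> exp (- (real x * t * (1 - 3/2 * t))) * real (n choose x)"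
        using power_sum_le_exp[of t x] t True by (intro mult_right_mono) auto
      finally have c: "real ?c \<le> exp (- (real x * t * (1 - 3/2 * t))) * real (n choose x)" .
      also have "\<dots> \<le> 1 * real (n choose x)" using t by (intro mult_right_mono) auto
      finally have cn: "?c \<le> n choose x" by simp
      have "real (?c choose k x) / real ((n choose x) choose k x) \<le> (real ?c / real (n choose x)) ^ k x"
        using cn k[OF x] by (rule binomial_ratio_le_power)
      also have "\<dots> \<le> exp (- (real x * t * (1 - 3/2 * t))) ^ k x"
        using c pos by (intro power_mono) (auto simp: divide_le_eq)
      also have "\<dots> = exp (- D x)"
        using True by (simp add: D_def algebra_simps flip: exp_of_nat_mult)
      finally show ?thesis using k[OF x] by (simp add: divide_le_eq)
    qed
    then show "0 \<le> real (?c choose k x) \<and>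
        real (?c choose k x) \<le> exp (- D x) * real ((n choose x) choose k x)" by simp
  qed
  also have "\<dots> = exp (- (\<Sum>x=1..n. D x)) * real (card (sized_families (nonempty_subsets n) n k))"
    by (simp add: card_all_families prod.distrib exp_sum sum_negf[symmetric] del: One_nat_def)
  also have "(\<Sum>x=1..n. D x) = (\<Sum>x=2..n. real x * real (k x) * (t * (1 - 3/2 * t)))"
    by (rule sum.mono_neutral_cong_right) (auto simp: D_def)
  also have "\<dots> = real j * L * (1 - 3/2 * t)"
    unfolding sum_distrib_right[symmetric] L_def t_def by simp
  finally show ?thesis unfolding j_def t_def .
qed

text \<open>Take \<open>A\<close> to be the smaller side of a partition that no hyperedge crosses.
  This restricts the union bound to sets of at most half the vertices.\<close>

lemma disconnected_imp_uncut:
  assumes "E \<subseteq> nonempty_subsets n" "\<not> hg_connected {1..n} E"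
  shows "\<exists>A. A \<subseteq> {1..n} \<and> A \<noteq> {} \<and> 2 * card A \<le> n \<and> E \<subseteq> uncut_sets n A"
proof -
  obtain V1 V2 where V: "V1 \<noteq> {}" "V2 \<noteq> {}" "V1 \<inter> V2 = {}" "V1 \<union> V2 = {1..n}"
    and no: "\<And>e. e \<in> E \<Longrightarrow> e \<inter> V1 = {} \<or> e \<inter> V2 = {}"
    using assms(2) unfolding hg_connected_def by metis
  have eq: "{1..n} - V1 = V2" "{1..n} - V2 = V1" using V by blast+
  have "finite V1" "finite V2" using V(4) by (metis finite_Un finite_atLeastAtMost)+
  then have "card V1 + card V2 = n" using card_Un_disjoint[of V1 V2] V by simp
  then have "2 * card V1 \<le> n \<or> 2 * card V2 \<le> n" by linarith
  moreover have "E \<subseteq> uncut_sets n V1" "E \<subseteq> uncut_sets n V2"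
    using assms(1) no V(4) unfolding uncut_sets_def eq nonempty_subsets_def by blast+
  ultimately show ?thesis using V by blast
qed

text \<open>Summing \<open>uncut_ratio_le\<close> over all \<open>A\<close> of size \<open>j\<close>
  gives at most \<open>q ^ j\<close> by \<open>binomial_mult_exp_le\<close>, and the geometric
  series is dominated by its first term.\<close>

lemma disconnected_bound:
  fixes w :: real
  assumes k: "\<And>x. x \<in> {1..n} \<Longrightarrow> k x \<le> n choose x"
    and w: "14 \<le> w" "ln n + w \<le> (\<Sum>x=2..n. real x * real (k x)) / n"
  shows "real (card {E\<in>sized_families (nonempty_subsets n) n k. \<not> hg_connected {1..n} E})
    \<le> 2 * exp (- (w / 4 - 5/2)) * real (card (sized_families (nonempty_subsets n) n k))"
proof -
  let ?H = "sized_families (nonempty_subsets n) n k"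
  define L where "L = (\<Sum>x=2..n. real x * real (k x)) / n"
  define q where "q = exp (- (w / 4 - 5/2))"
  \<comment> \<open>The threshold 14 makes \<open>w / 4 - 5/2\<close> at least 1, which gives
    \<open>q \<le> 1/2\<close> below.\<close>
  have "q \<le> exp (- 1)" using w by (simp add: q_def)
  also have "exp (- 1) \<le> (1/2 :: real)" 
    using exp_ge_add_one_self[of 1] by (simp add: exp_minus field_simps)
  finally have q: "0 \<le> q" "q \<le> 1/2" by (auto simp: q_def)
  let ?As = "\<lambda>j. {A. A \<subseteq> {1..n} \<and> card A = j}"
  have fin: "finite (?As j)" for j by (rule finite_subset[of _ "Pow {1..n}"]) auto
  have finS: "finite (sized_families (uncut_sets n A) n k)" for A
    by (intro finite_class_families) (auto simp: uncut_sets_def finite_nonempty_subsets)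
  have "{E\<in>?H. \<not> hg_connected {1..n} E}
      \<subseteq> (\<Union>j\<in>{1..n div 2}. \<Union>A\<in>?As j. sized_families (uncut_sets n A) n k)"
  proof
    fix E assume E: "E \<in> {E\<in>?H. \<not> hg_connected {1..n} E}"
    then obtain A where A: "A \<subseteq> {1..n}" "A \<noteq> {}" "2 * card A \<le> n" "E \<subseteq> uncut_sets n A"
      using disconnected_imp_uncut[of E n] by (auto simp: class_families_def)
    have "card A \<noteq> 0" using A(1,2) finite_subset[of A "{1..n}"] by auto
    then have "card A \<in> {1..n div 2}" using A(3) by auto
    moreover have "E \<in> sized_families (uncut_sets n A) n k"
      using E A(4) by (auto simp: class_families_def)
    ultimately show "E \<in> (\<Union>j\<in>{1..n div 2}. \<Union>A\<in>?As j. sized_families (uncut_sets n A) n k)"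
      using A(1) by blast
  qed
  then have "card {E\<in>?H. \<not> hg_connected {1..n} E}
      \<le> card (\<Union>j\<in>{1..n div 2}. \<Union>A\<in>?As j. sized_families (uncut_sets n A) n k)"
    by (rule card_mono[rotated]) (use fin finS in auto)
  also have "\<dots> \<le> (\<Sum>j=1..n div 2. \<Sum>A\<in>?As j. card (sized_families (uncut_sets n A) n k))"
    by (rule order_trans[OF card_UN_le sum_mono[OF card_UN_le]]) (use fin in auto)
  finally have "real (card {E\<in>?H. \<not> hg_connected {1..n} E})
      \<le> (\<Sum>j=1..n div 2. \<Sum>A\<in>?As j. real (card (sized_families (uncut_sets n A) n k)))"
    by (simp flip: of_nat_sum)
  also have "\<dots> \<le> (\<Sum>j=1..n div 2. q ^ j * real (card ?H))"
  proof (rule sum_mono)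
    fix j assume j: "j \<in> {1..n div 2}"
    have "(\<Sum>A\<in>?As j. real (card (sized_families (uncut_sets n A) n k)))
        \<le> (\<Sum>A\<in>?As j. exp (- (real j * L * (1 - 3/2 * (real j / n)))) * real (card ?H))"
    proof (rule sum_mono)
      fix A assume A: "A \<in> ?As j"
      then have "A \<subseteq> {1..n}" "A \<noteq> {}" "2 * card A \<le> n" using j by auto
      from uncut_ratio_le[OF this k] A show "real (card (sized_families (uncut_sets n A) n k))
          \<le> exp (- (real j * L * (1 - 3/2 * (real j / n)))) * real (card ?H)" unfolding L_def by blast
    qed
    also have "\<dots> = (real (n choose j) * exp (- (real j * L * (1 - 3/2 * (real j / n))))) * real (card ?H)"
      by (simp add: n_subsets)
    also have "\<dots> \<le> q ^ j * real (card ?H)"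
      unfolding q_def using j w by (intro mult_right_mono binomial_mult_exp_le) (auto simp: L_def)
    finally show "(\<Sum>A\<in>?As j. real (card (sized_families (uncut_sets n A) n k))) \<le> q ^ j * real (card ?H)" .
  qed
  also have "\<dots> = (\<Sum>j=1..n div 2. q ^ j) * real (card ?H)" by (simp add: sum_distrib_right)
  also have "(\<Sum>j=1..n div 2. q ^ j) \<le> 2 * q"
  proof -
    \<comment> \<open>The factor \<open>1 - q ^ r\<close> strengthens the claim so that the
      induction closes.\<close>
    have *: "(\<Sum>j=1..r. q ^ j) \<le> 2 * q * (1 - q ^ r)" for r
    proof (induction r)
      case (Suc r)
      have "q ^ r * q \<le> 2 * (1 - q) * (q ^ r * q)"
        using q mult_right_mono[of 1 "2 * (1 - q)" "q ^ r * q"] by simp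
      then show ?case using Suc by (simp add: algebra_simps)
    qed simp
    show ?thesis using q by (intro order_trans[OF *]) (simp add: mult_left_le)
  qed
  finally show ?thesis by (simp add: q_def mult_right_mono)
qed


section \<open>Isolated vertices\<close>

text \<open>Singletons remain unrestricted: a hyperedge \<open>{v}\<close> does not join
  \<open>v\<close> to another vertex. For \<open>U = {u, v}\<close> the families over this ground
  set are those isolating both vertices.\<close>

definition isolating_sets :: "nat \<Rightarrow> nat set \<Rightarrow> nat set set" where
  "isolating_sets n U = {e\<in>nonempty_subsets n. card e \<ge> 2 \<longrightarrow> e \<inter> U = {}}"

lemma card_isolating_families:
  assumes U: "U \<subseteq> {1..n}" "card U = c"
  shows "card (sized_families (isolating_sets n U) n k)
    = (\<Prod>x=1..n. ((if x \<ge> 2 then n - c else n) choose x) choose k x)"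
proof -
  have "card {e\<in>isolating_sets n U. card e = x} = (if x \<ge> 2 then n - c else n) choose x"
    if x: "x \<in> {1..n}" for x
  proof -
    let ?A = "if x \<ge> 2 then {1..n} - U else {1..n}"
    have "{e\<in>isolating_sets n U. card e = x} = {e\<in>nonempty_subsets n. e \<subseteq> ?A \<and> card e = x}"
      by (auto simp: isolating_sets_def nonempty_subsets_def)
    moreover have "card ?A = (if x \<ge> 2 then n - c else n)"
      using U by (simp add: card_Diff_subset finite_subset)
    ultimately show ?thesis using x card_subsets_of_size[of ?A n x] by simp
  qed
  then show ?thesis by (subst card_sized_families) (auto simp: isolating_sets_def)
qed

lemma isolated_imp_disconnected:
  assumes "v \<in> {1..n}" "n \<ge> 2" "E \<subseteq> isolating_sets n {v}"
  shows "\<not> hg_connected {1..n} E"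
proof
  assume "hg_connected {1..n} E"
  moreover have "{1..n} - {v} \<noteq> {}"
  proof
    assume "{1..n} - {v} = {}"
    then have "card {1..n} \<le> card {v}" by (intro card_mono) auto
    then show False using assms(2) by simp
  qed
  ultimately obtain e where e: "e \<in> E" "e \<inter> {v} \<noteq> {}" "e \<inter> ({1..n} - {v}) \<noteq> {}"
    using assms(1) unfolding hg_connected_def
    by (metis Diff_disjoint Diff_partition empty_subsetI insert_not_empty insert_subset)
  then obtain u where u: "u \<in> e" "u \<noteq> v" "v \<in> e" by blast
  have "finite e" using e(1) assms(3)
    by (auto simp: isolating_sets_def nonempty_subsets_def dest: finite_subset)
  then have "card {u, v} \<le> card e" using u by (intro card_mono) auto
  then have "card e \<ge> 2" using u by simp
  then show False using e(1) assms(3) u by (auto simp: isolating_sets_def)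
qed

text \<open>Both sides factor over the sizes, so it suffices to apply
  \<open>binomial_mult_le_square\<close> to each size. Its assumptions say that
  \<open>n choose x\<close> is convex and log-concave in \<open>n\<close>.\<close>

lemma isolated_negatively_correlated:
  assumes uv: "u \<in> {1..n}" "v \<in> {1..n}" "u \<noteq> v"
  shows "card (sized_families (isolating_sets n {u, v}) n k) * card (sized_families (nonempty_subsets n) n k)
    \<le> (card (sized_families (isolating_sets n {v}) n k))\<^sup>2"
proof -
  have n: "n \<ge> 2" using uv by auto
  have "((n - 2 choose x) choose j) * ((n choose x) choose j) \<le> ((n - 1 choose x) choose j)\<^sup>2"
    if x: "x \<ge> 1" for x j
  proof (rule binomial_mult_le_square)
    obtain y where y: "x = Suc y" using x by (cases x) auto
    obtain r where r: "n = Suc (Suc r)" using n by (metis add_2_eq_Suc le_Suc_ex)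
    \<comment> \<open>By Pascal's rule, convexity is monotonicity of the first differences.\<close>
    have "r choose y \<le> Suc r choose y" by (rule binomial_right_mono) simp
    then show "2 * (n - 1 choose x) \<le> (n - 2 choose x) + (n choose x)"
      by (simp add: y r)
    show "n - 2 choose x \<le> n - 1 choose x" "n - 1 choose x \<le> n choose x"
      by (auto intro: binomial_right_mono)
    show "(n - 2 choose x) * (n choose x) \<le> (n - 1 choose x)\<^sup>2"
    proof -
      define N N1 N2 where "N = n choose x" and "N1 = Suc r choose x" and "N2 = r choose x"
      have 1: "n * N1 = (n - x) * N"
        using binomial_absorb_comp[of n x] by (simp add: N_def N1_def r)
      have 2: "Suc r * N2 = (Suc r - x) * N1"
        using binomial_absorb_comp[of "Suc r" x] by (simp add: N2_def N1_def)
      \<comment> \<open>Log-concavity: the quotient \<open>N2 / N1 = (n - 1 - x) / (n - 1)\<close>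
        is at most \<open>N1 / N = (n - x) / n\<close>, written without division.\<close>
      have 3: "n * (Suc r - x) \<le> Suc r * (n - x)"
      proof (cases "x \<le> Suc r")
        case True
        then obtain d where "Suc r = x + d" using le_Suc_ex by blast
        then show ?thesis by (simp add: r algebra_simps)
      qed simp
      have "Suc r * n * (N2 * N) = n * (Suc r - x) * (N1 * N)"
        using 2 by (metis (no_types, lifting) mult.assoc mult.left_commute)
      also have "\<dots> \<le> Suc r * (n - x) * (N1 * N)" using 3 by (rule mult_le_mono1)
      also have "\<dots> = Suc r * n * (N1 * N1)"
        using 1 by (metis (no_types, lifting) mult.assoc mult.left_commute)
      finally have "N2 * N \<le> N1 * N1" using n by simp
      then show ?thesis by (simp add: N_def N1_def N2_def r power2_eq_square)
    qed
  qed
  then have "(\<Prod>x=1..n. (((if x \<ge> 2 then n - 2 else n) choose x) choose k x) * ((n choose x) choose k x))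
     \<le> (\<Prod>x=1..n. ((((if x \<ge> 2 then n - 1 else n) choose x) choose k x))\<^sup>2)"
    by (intro prod_mono) (auto simp: power2_eq_square)
  then show ?thesis
    using uv card_isolating_families[of "{u, v}" n 2 k] card_isolating_families[of "{v}" n 1 k]
    by (simp add: card_all_families prod.distrib prod_power_distrib del: One_nat_def)
qed

text \<open>Multiply \<open>exp_le_binomial_ratio\<close> over all sizes. The assumptions
  \<open>sq\<close> and \<open>second\<close> bound the total errors by 1/4 and 8/16, which together
  stay below the 1 in the exponent.\<close>

lemma isolated_ratio_ge:
  assumes k: "\<And>x. x \<in> {1..n} \<Longrightarrow> k x \<le> n choose x" and v: "v \<in> {1..n}"
    and large: "\<And>x. x \<in> {2..n} \<Longrightarrow> k x > 0 \<Longrightarrow> 4 * x \<le> n"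
    and sq: "(\<Sum>x=2..n. (real (k x))\<^sup>2 / real (n choose x)) \<le> 1/4"
    and second: "16 * (\<Sum>x=2..n. (real x)\<^sup>2 * real (k x)) \<le> (real n)\<^sup>2"
  shows "exp (- ((\<Sum>x=2..n. real x * real (k x)) / n + 1)) * real (card (sized_families (nonempty_subsets n) n k))
    \<le> real (card (sized_families (isolating_sets n {v}) n k))"
proof -
  define D where "D x = (if x \<ge> 2 then real x * real (k x) / n + (real (k x))\<^sup>2 / (n choose x)
      + 8 * (real x)\<^sup>2 * real (k x) / (real n)\<^sup>2 else 0)" for x
  have n: "n > 0" using v by auto
  have "(\<Sum>x=1..n. D x) = (\<Sum>x=2..n. real x * real (k x) / n + (real (k x))\<^sup>2 / (n choose x)
      + 8 * (real x)\<^sup>2 * real (k x) / (real n)\<^sup>2)"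
    by (rule sum.mono_neutral_cong_right) (auto simp: D_def)
  also have "\<dots> = (\<Sum>x=2..n. real x * real (k x)) / n + (\<Sum>x=2..n. (real (k x))\<^sup>2 / (n choose x))
      + 8 * (\<Sum>x=2..n. (real x)\<^sup>2 * real (k x)) / (real n)\<^sup>2"
    by (simp add: sum.distrib sum_divide_distrib sum_distrib_left mult.assoc)
  also have "\<dots> \<le> (\<Sum>x=2..n. real x * real (k x)) / n + 1/4 + 1/2"
    using sq second n by (intro add_mono) (auto simp: field_simps)
  finally have "exp (- ((\<Sum>x=2..n. real x * real (k x)) / n + 1)) \<le> exp (- (\<Sum>x=1..n. D x))"
    by simp
  then have "exp (- ((\<Sum>x=2..n. real x * real (k x)) / n + 1)) * real (card (sized_families (nonempty_subsets n) n k))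
      \<le> exp (- (\<Sum>x=1..n. D x)) * real (card (sized_families (nonempty_subsets n) n k))"
    by (intro mult_right_mono) auto
  also have "\<dots> = (\<Prod>x=1..n. exp (- D x) * real ((n choose x) choose k x))"
    by (simp add: card_all_families prod.distrib exp_sum sum_negf[symmetric] del: One_nat_def)
  also have "\<dots> \<le> (\<Prod>x=1..n. real (((if x \<ge> 2 then n - 1 else n) choose x) choose k x))"
  proof (rule prod_mono)
    fix x assume x: "x \<in> {1..n}"
    have "exp (- D x) * real ((n choose x) choose k x)
      \<le> real (((if x \<ge> 2 then n - 1 else n) choose x) choose k x)"
    proof (cases "x \<ge> 2 \<and> k x > 0")
      case True
      then have x2: "x \<in> {2..n}" using x by simp
      \<comment> \<open>One summand is at most the whole sum, so \<open>sq\<close> also supplies the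
        size condition on \<open>k x\<close> needed by \<open>exp_le_binomial_ratio\<close>.\<close>
      have "(real (k x))\<^sup>2 / real (n choose x) \<le> (\<Sum>x=2..n. (real (k x))\<^sup>2 / real (n choose x))"
        using x2 by (intro member_le_sum) auto
      with sq have "(real (k x))\<^sup>2 / real (n choose x) \<le> 1/4" by linarith
      then have "4 * (real (k x))\<^sup>2 \<le> real (n choose x)" using x by (simp add: divide_le_eq)
      from exp_le_binomial_ratio[OF n large[OF x2] this] True
      show ?thesis using k[OF x] by (simp add: D_def le_divide_eq)
    next
      case False
      then show ?thesis by (auto simp: D_def)
    qed
    then show "0 \<le> exp (- D x) * real ((n choose x) choose k x) \<and> exp (- D x) * real ((n choose x) choose k x)
      \<le> real (((if x \<ge> 2 then n - 1 else n) choose x) choose k x)" by simp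
  qed
  also have "\<dots> = real (card (sized_families (isolating_sets n {v}) n k))"
    using v card_isolating_families[of "{v}" n 1 k] by simp
  finally show ?thesis .
qed

text \<open>A connected hypergraph on at least two vertices has no isolated vertex. The second
  moment bound therefore applies, with the mean number of isolated vertices estimated from below by
  \<open>isolated_ratio_ge\<close>.\<close>

lemma connected_bound:
  assumes n: "n \<ge> 2" and k: "\<And>x. x \<in> {1..n} \<Longrightarrow> k x \<le> n choose x"
    and large: "\<And>x. x \<in> {2..n} \<Longrightarrow> k x > 0 \<Longrightarrow> 4 * x \<le> n"
    and sq: "(\<Sum>x=2..n. (real (k x))\<^sup>2 / real (n choose x)) \<le> 1/4"
    and second: "16 * (\<Sum>x=2..n. (real x)\<^sup>2 * real (k x)) \<le> (real n)\<^sup>2"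
  shows "real (card {E\<in>sized_families (nonempty_subsets n) n k. hg_connected {1..n} E})
    \<le> exp (- (ln n - (\<Sum>x=2..n. real x * real (k x)) / n - 1))
      * real (card (sized_families (nonempty_subsets n) n k))"
proof -
  let ?H = "sized_families (nonempty_subsets n) n k"
  let ?P = "\<lambda>v E. E \<subseteq> isolating_sets n {v}"
  define L where "L = (\<Sum>x=2..n. real x * real (k x)) / n"
  define a where "a = card (sized_families (isolating_sets n {1}) n k)"
  define h where "h = real (card ?H)"
  define z where "z = real (card {E\<in>?H. hg_connected {1..n} E})"
  have finH: "finite ?H" by (intro finite_class_families finite_nonempty_subsets)
  have h: "h > 0" using k unfolding h_def card_all_families of_nat_prod by (intro prod_pos) auto
  have restrict: "{E\<in>?H. E \<subseteq> isolating_sets n U} = sized_families (isolating_sets n U) n k" for U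
    by (auto simp: class_families_def isolating_sets_def)
  have single: "card (sized_families (isolating_sets n {v}) n k) = a" if "v \<in> {1..n}" for v
    using that n card_isolating_families[of "{v}" n 1 k] card_isolating_families[of "{1}" n 1 k]
    by (simp add: a_def)
  have pair: "{E\<in>?H. ?P u E \<and> ?P v E} = sized_families (isolating_sets n {u, v}) n k" for u v
    unfolding restrict[symmetric] by (auto simp: isolating_sets_def)
  have "real (card {E\<in>?H. \<forall>v\<in>{1..n}. \<not> ?P v E}) * (real (card {1..n}) * real a) \<le> (real (card ?H))\<^sup>2"
  proof (rule second_moment_count[OF finH])
    show "card {E\<in>?H. ?P v E} = a" if "v \<in> {1..n}" for v
      using that by (simp only: restrict single)
    show "card {E\<in>?H. ?P u E \<and> ?P v E} * card ?H \<le> a\<^sup>2"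
      if "u \<in> {1..n}" "v \<in> {1..n}" "u \<noteq> v" for u v
      using isolated_negatively_correlated[OF that, of k] that by (simp only: pair single)
  qed simp
  moreover have z: "z \<le> real (card {E\<in>?H. \<forall>v\<in>{1..n}. \<not> ?P v E})"
    unfolding z_def using n isolated_imp_disconnected finH
    by (intro of_nat_mono card_mono) auto
  moreover have a: "exp (- (L + 1)) * h \<le> real a"
    unfolding L_def h_def a_def using n by (intro isolated_ratio_ge k large sq second) auto
  moreover have "z * (real n * (exp (- (L + 1)) * h))
      \<le> real (card {E\<in>?H. \<forall>v\<in>{1..n}. \<not> ?P v E}) * (real n * real a)"
    using z a h by (intro mult_mono) auto
  ultimately have "z * (real n * (exp (- (L + 1)) * h)) \<le> h\<^sup>2"
    by (simp add: h_def)
  then have "z * real n * exp (- (L + 1)) \<le> h" using h by (simp add: power2_eq_square)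
  then have "z \<le> h / (exp (ln n) * exp (- (L + 1)))" using n by (simp add: field_simps)
  also have "\<dots> = exp (- (ln n - L - 1)) * h"
    by (simp add: exp_add[symmetric] exp_minus[symmetric] divide_inverse)
  finally show ?thesis by (simp add: z_def L_def h_def)
qed

section \<open>From the hypergraph model to the two limits\<close>

text \<open>The counts \<open>k x\<close> sum to \<open>m\<close>, so prescribing them already
  forces \<open>card E = m\<close>. Thus the uniform model is a product over the sizes.\<close>

lemma hgraphs_eq_sized_families:
  assumes m: "m \<ge> 1" and f: "(\<Sum>x=1..n. f x) = 1"
    and k: "\<And>x. x \<in> {1..n} \<Longrightarrow> real (k x) = real m * f x"
  shows "hgraphs n m f = sized_families (nonempty_subsets n) n k"
proof -
  have card_eq: "card E = (\<Sum>x=1..n. card {e\<in>E. card e = x})" if "E \<subseteq> nonempty_subsets n" for E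
  proof -
    have "finite E" using that finite_nonempty_subsets by (rule finite_subset)
    moreover have "E = (\<Union>x\<in>{1..n}. {e\<in>E. card e = x})"
      using that card_nonempty_subsets[of n] by auto
    ultimately show ?thesis by (subst card_UN_disjoint[symmetric]) auto
  qed
  have "real (\<Sum>x=1..n. k x) = real m"
    using f by (simp add: k flip: sum_distrib_left del: One_nat_def)
  then have card_m: "card E = m" if "E \<in> sized_families (nonempty_subsets n) n k" for E
    using that card_eq[of E] unfolding of_nat_eq_iff by (auto simp: class_families_def)
  have freq: "real c / real m = f x \<longleftrightarrow> c = k x" if "x \<in> {1..n}" for c x
    using k[OF that] m by (auto simp: field_simps simp flip: of_nat_mult)
  have "E \<in> hgraphs n m f \<longleftrightarrow> E \<subseteq> nonempty_subsets n \<and> card E = m \<and>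
      (\<forall>x\<in>{1..n}. real (card {e\<in>E. card e = x}) / real m = f x)" for E
    unfolding hgraphs_def emp_size_dist_def nonempty_subsets_def by fastforce
  then have "E \<in> hgraphs n m f \<longleftrightarrow> card E = m \<and> E \<in> sized_families (nonempty_subsets n) n k" for E
    using freq by (simp add: class_families_def del: One_nat_def) blast
  with card_m show ?thesis by blast
qed


theorem mainTheorem1:
  fixes m :: "nat \<Rightarrow> nat" and f :: "nat \<Rightarrow> nat \<Rightarrow> real"
  assumes m_pos: "\<And>n. n \<ge> 1 \<Longrightarrow> m n \<ge> 1"
    and f_nonneg: "\<And>n x. n \<ge> 1 \<Longrightarrow> x \<in> {1..n} \<Longrightarrow> f n x \<ge> 0"
    and f_sum: "\<And>n. n \<ge> 1 \<Longrightarrow> (\<Sum>x=1..n. f n x) = 1"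
    and f_int: "\<And>n x. n \<ge> 1 \<Longrightarrow> x \<in> {1..n} \<Longrightarrow> real (m n) * f n x \<in> \<int>"
    and f_le: "\<And>n x. n \<ge> 1 \<Longrightarrow> x \<in> {1..n} \<Longrightarrow> real (m n) * f n x \<le> real (n choose x)"
    and small: "(\<lambda>n. \<Sum>x=1..n. f n x ^ 2 / real (n choose x))
                  \<in> o(\<lambda>n. 1 / real (m n) ^ 2)"
    and mom: "(\<lambda>n. moment 2 n (f n)) \<in> O(\<lambda>n. moment 0 n (f n))"
  shows "(filterlim (\<lambda>n. ln (real n) - real (m n) / real n * moment 1 n (f n)) at_top at_top
            \<longrightarrow> ((\<lambda>n. prob_connected n (m n) (f n)) \<longlonglongrightarrow> 0))
       \<and> (filterlim (\<lambda>n. ln (real n) - real (m n) / real n * moment 1 n (f n)) at_bot at_top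
            \<longrightarrow> ((\<lambda>n. prob_connected n (m n) (f n)) \<longlonglongrightarrow> 1))"
proof -
  define g where "g n = ln (real n) - real (m n) / real n * moment 1 n (f n)" for n
  define p where "p n = prob_connected n (m n) (f n)" for n
  \<comment> \<open>By integrality and nonnegativity the rounding is exact.\<close>
  define k where "k n x = nat \<lfloor>real (m n) * f n x\<rfloor>" for n x
  define H where "H n = sized_families (nonempty_subsets n) n (k n)" for n
  have k: "real (k n x) = real (m n) * f n x" if "n \<ge> 1" "x \<in> {1..n}" for n x
    using f_int[OF that] f_nonneg[OF that] by (auto simp: k_def elim!: Ints_cases)
  have k_le: "k n x \<le> n choose x" if "n \<ge> 1" "x \<in> {1..n}" for n x
    using f_le[OF that] k[OF that] by simp
  have hgraphs: "hgraphs n (m n) (f n) = H n" if "n \<ge> 1" for n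
    unfolding H_def using that m_pos f_sum k by (intro hgraphs_eq_sized_families) auto
  have fin_H: "finite (H n)" for n
    unfolding H_def by (intro finite_class_families finite_nonempty_subsets)
  have H_pos: "real (card (H n)) > 0" if "n \<ge> 1" for n
    using k_le[OF that] unfolding H_def card_all_families of_nat_prod by (intro prod_pos) auto
  have moments: "(\<Sum>x=2..n. real x ^ r * real (k n x)) = real (m n) * moment r n (f n)"
    if "n \<ge> 1" for n r
    unfolding moment_def sum_distrib_left by (rule sum.cong) (auto simp: k[OF that])
  have g: "g n = ln n - (\<Sum>x=2..n. real x * real (k n x)) / n" if "n \<ge> 1" for n
    using moments[OF that, of 1] by (simp add: g_def)
  have p: "p n = real (card {E\<in>H n. hg_connected {1..n} E}) / real (card (H n))" if "n \<ge> 1" for n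
    by (simp add: p_def prob_connected_def hgraphs[OF that])
  have p_range: "0 \<le> p n" "p n \<le> 1" if "n \<ge> 1" for n
    using H_pos[OF that] card_mono[OF fin_H, of "{E\<in>H n. hg_connected {1..n} E}" n]
    by (auto simp: p[OF that] divide_le_eq)
  have "p \<longlonglongrightarrow> 0" if lim: "filterlim g at_top at_top"
  proof (rule tendsto_sandwich)
    show "\<forall>\<^sub>F n in sequentially. 0 \<le> p n"
      using eventually_ge_at_top[of 1] by eventually_elim (rule p_range)
    show "(\<lambda>n. exp (- (g n - 1))) \<longlonglongrightarrow> 0"
    proof -
      have "(\<lambda>n. exp (- g n)) \<longlonglongrightarrow> 0"
        using lim by (intro filterlim_compose[OF exp_at_bot]) (simp add: filterlim_uminus_at_bot)
      then have "(\<lambda>n. exp 1 * exp (- g n)) \<longlonglongrightarrow> exp 1 * 0" by (intro tendsto_intros)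
      then show ?thesis by (simp flip: exp_add)
    qed
    obtain C where C: "C > 0"
      "\<forall>\<^sub>F n in sequentially. norm (moment 2 n (f n)) \<le> C * norm (moment 0 n (f n))"
      using mom by (elim landau_o.bigE) auto
    have sq: "\<forall>\<^sub>F n in sequentially. norm (\<Sum>x=1..n. f n x ^ 2 / real (n choose x))
        \<le> 1/4 * norm (1 / real (m n) ^ 2)"
      using small by (rule landau_o.smallD) simp
    \<comment> \<open>This threshold is chosen so that \<open>C n ln n\<close> is at most
      \<open>n * (n / 16)\<close> in the chain for \<open>M 2\<close> below.\<close>
    have "\<forall>\<^sub>F n in sequentially. ln (real n) / real n < 1 / (16 * C)"
      using C(1) by (intro order_tendstoD(2)[OF lim_ln_over_n]) auto
    moreover have "\<forall>\<^sub>F n in sequentially. g n \<ge> 0"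
      using lim by (simp add: filterlim_at_top)
    ultimately show "\<forall>\<^sub>F n in sequentially. p n \<le> exp (- (g n - 1))"
      using C(2) sq eventually_ge_at_top[of 2]
    proof eventually_elim
      case (elim n)
      then have n: "n \<ge> 1" by simp
      define M where "M r = (\<Sum>x=2..n. real x ^ r * real (k n x))" for r
      have m: "real (m n) > 0" using m_pos[OF n] by simp
      have M_nonneg: "M r \<ge> 0" for r unfolding M_def by (intro sum_nonneg) auto
      have mom_M: "moment r n (f n) = M r / real (m n)" for r
        using moments[OF n, of r] m by (simp add: M_def)
      \<comment> \<open>The sums start at size 2, so \<open>M 0 \<le> M 1\<close>, and
        \<open>g n \<ge> 0\<close> says that \<open>M 1\<close> is at most \<open>n ln n\<close>.
        Hence the second moment is too small for large hyperedges to occur.\<close>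
      have "M 2 \<le> C * M 0"
        using elim(3) m M_nonneg by (simp add: mom_M field_simps)
      also have "\<dots> \<le> C * M 1"
        unfolding M_def using C(1)
        by (intro mult_left_mono sum_mono mult_right_mono) auto
      also have "M 1 \<le> n * ln n"
        using elim(2) n by (simp add: g[OF n] M_def field_simps)
      also have "C * (n * ln n) \<le> n * (n / 16)"
        using elim(1) n C(1) by (simp add: field_simps)
      finally have M2: "16 * M 2 \<le> (real n)\<^sup>2"
        using C(1) by (simp add: power2_eq_square)
      have "real (card {E\<in>H n. hg_connected {1..n} E})
          \<le> exp (- (ln n - (\<Sum>x=2..n. real x * real (k n x)) / n - 1)) * real (card (H n))"
        unfolding H_def
      proof (rule connected_bound)
        show "n \<ge> 2" by fact
        show "k n x \<le> n choose x" if "x \<in> {1..n}" for x using n that by (rule k_le)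
        show "16 * (\<Sum>x=2..n. (real x)\<^sup>2 * real (k n x)) \<le> (real n)\<^sup>2"
          using M2 by (simp add: M_def)
        show "4 * x \<le> n" if x: "x \<in> {2..n}" "k n x > 0" for x
        proof -
          \<comment> \<open>A size that occurs at all contributes at least \<open>x\<close> squared
            to \<open>M 2\<close>.\<close>
          have "(real x)\<^sup>2 * 1 \<le> (real x)\<^sup>2 * real (k n x)" using x by (intro mult_left_mono) auto
          also have "\<dots> \<le> M 2" unfolding M_def using x by (intro member_le_sum) auto
          finally have "(4 * real x)\<^sup>2 \<le> (real n)\<^sup>2" using M2 by (simp add: power_mult_distrib)
          then have "4 * real x \<le> real n" by (rule power2_le_imp_le) simp
          then show ?thesis by simp
        qed
        have "(\<Sum>x=2..n. (real (k n x))\<^sup>2 / real (n choose x))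
            \<le> (\<Sum>x=1..n. (real (k n x))\<^sup>2 / real (n choose x))"
          by (intro sum_mono2) auto
        also have "\<dots> = (real (m n))\<^sup>2 * (\<Sum>x=1..n. (f n x)\<^sup>2 / real (n choose x))"
          unfolding sum_distrib_left by (rule sum.cong) (auto simp: k[OF n] power_mult_distrib)
        also have "\<dots> \<le> (real (m n))\<^sup>2 * (1/4 * (1 / (real (m n))\<^sup>2))"
          using elim(4) by (intro mult_left_mono) auto
        also have "\<dots> = 1/4" using m by simp
        finally show "(\<Sum>x=2..n. (real (k n x))\<^sup>2 / real (n choose x)) \<le> 1/4" .
      qed
      then show ?case using H_pos[OF n] by (simp add: p[OF n] g[OF n] divide_le_eq)
    qed
  qed simp
  moreover have "p \<longlonglongrightarrow> 1" if lim: "filterlim g at_bot at_top"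
  proof (rule tendsto_sandwich)
    show "\<forall>\<^sub>F n in sequentially. p n \<le> 1"
      using eventually_ge_at_top[of 1] by eventually_elim (rule p_range)
    have "filterlim (\<lambda>n. 1/4 * g n) at_bot sequentially"
      by (intro filterlim_tendsto_pos_mult_at_bot[OF tendsto_const _ lim]) auto
    then have "(\<lambda>n. exp (1/4 * g n)) \<longlonglongrightarrow> 0"
      by (rule filterlim_compose[OF exp_at_bot])
    then have "(\<lambda>n. 1 - 2 * (exp (5/2) * exp (1/4 * g n))) \<longlonglongrightarrow> 1 - 2 * (exp (5/2) * 0)"
      by (intro tendsto_intros)
    then show "(\<lambda>n. 1 - 2 * exp (5/2 + 1/4 * g n)) \<longlonglongrightarrow> 1" by (simp add: exp_add)
    have "\<forall>\<^sub>F n in sequentially. g n \<le> - 14"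
      using lim by (simp add: filterlim_at_bot)
    then show "\<forall>\<^sub>F n in sequentially. 1 - 2 * exp (5/2 + 1/4 * g n) \<le> p n"
      using eventually_ge_at_top[of 1]
    proof eventually_elim
      case (elim n)
      note n = elim(2)
      \<comment> \<open>Here \<open>w = - g n\<close>, for which \<open>ln n + w\<close> equals the
        scaled first moment exactly.\<close>
      have "real (card {E\<in>H n. \<not> hg_connected {1..n} E})
          \<le> 2 * exp (- (- g n / 4 - 5/2)) * real (card (H n))"
        unfolding H_def by (rule disconnected_bound) (use k_le[OF n] elim(1) g[OF n] in auto)
      moreover have "card (H n) = card {E\<in>H n. hg_connected {1..n} E} + card {E\<in>H n. \<not> hg_connected {1..n} E}"
        using fin_H by (subst card_Un_disjoint[symmetric]) (auto intro!: arg_cong[of _ _ card])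
      ultimately have "(1 - 2 * exp (5/2 + 1/4 * g n)) * real (card (H n))
          \<le> real (card {E\<in>H n. hg_connected {1..n} E})"
        by (simp add: algebra_simps)
      then show ?case using H_pos[OF n] by (simp add: p[OF n] le_divide_eq)
    qed
  qed simp
  ultimately show ?thesis unfolding g_def p_def by blast
qed

end
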